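(* Suppose the Finsler metric function is Riemannian, $F=S=\sqrt{a_{ij}(x)y^iy^j}$, let $k_n=k_n(x)$ be a (smooth) covariant vector field, and let $$L^k_n=-\frac{y^k}{S}\frac{\partial S}{\partial x^n}-S\,m^k\left(\frac{\partial\theta}{\partial x^n}-k_n\right).$$ Then $L^k_n=L^k{}_{nh}\,y^h$ with $$L^k{}_{nh}=-a^{kj}\epsilon^{\rm Riem}_{jh}T_n-a^k{}_{nh},\qquad T_n=n^h\nabla_n\tilde b_h+k_n .$$ The curvature tensor $$\bar L_k{}^n{}_{ij}=\frac{\partial\bar L^n{}_{jk}}{\partial x^i}-\frac{\partial\bar L^n{}_{ik}}{\partial x^j}+\bar L^m{}_{jk}\bar L^n{}_{im}-\bar L^m{}_{ik}\bar L^n{}_{jm}$$ of the coefficients $\bar L^k{}_{nh}=-L^k{}_{nh}$ is $$\bar L_k{}^n{}_{ij}=a^{nt}\epsilon^{\rm Riem}_{tk}\left(\frac{\partial k_j}{\partial x^i}-\frac{\partial k_i}{\partial x^j}\right).$$ Moreover $\bar L^k{}_{nh}=a^k{}_{nh}$ if and only if $k_n=-n^h\nabla_n\tilde b_h$, in which case $\bar L_k{}^n{}_{ij}$ is the ordinary Riemannian curvature tensor of $a_{mn}$.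
   Context: Local consideration on a 2-dimensional $C^\infty$ manifold $M$ with coordinates $x^1,x^2$ and fibre coordinates $y^1,y^2$. $a_{ij}(x)$ is a Riemannian metric tensor, $a^{ij}$ its inverse, $a^k{}_{nh}$ its Christoffel symbols, $\nabla_n$ its covariant derivative. With $\gamma_{11}=\gamma_{22}=0$, $\gamma_{12}=-\gamma_{21}=1$, put $\epsilon^{\rm Riem}_{jh}=\sqrt{\det(a_{mn})}\,\gamma_{jh}$, $l^k=y^k/S$, $m_i=-\epsilon^{\rm Riem}_{ik}l^k$, $m^i=a^{ij}m_j$. $\tilde b_h(x)$, $n_h(x)$ is a smooth pair of covector fields orthonormal with respect to $a_{ij}$ and oriented so that $\epsilon^{\rm Riem}_{kn}=\tilde b_kn_n-n_k\tilde b_n$; $\tilde b^i=a^{ij}\tilde b_j$, $n^i=a^{ij}n_j$. The angle function $\theta(x,y)$ is the smooth function (on a conic region containing $\tilde b(x)$), homogeneous of degree zero in $y$, with $S\,\partial\theta/\partial y^n=m_n$ and $\theta(x,\tilde b(x))=0$. The ordinary Riemannian curvature tensor is $a_k{}^n{}_{ij}=\partial a^n{}_{jk}/\partial x^i-\partial a^n{}_{ik}/\partial x^j+a^m{}_{jk}a^n{}_{im}-a^m{}_{ik}a^n{}_{jm}$. Repeated indices (running over $1,2$) are summed. *)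

theory Defs
  imports "HOL-Analysis.Analysis"
begin

text \<open>
  Everything is local: points \<open>x\<close> and fibre vectors \<open>y\<close> are elements of \<open>real^2\<close>, the metric is given
  by its component matrix \<open>a x\<close>, covector and vector fields by their components.  The index type is
  \<open>2\<close>, whose two elements are \<open>1\<close> and \<open>2\<close>.
\<close>

type_synonym idx = 2
type_synonym point = "real^2"
type_synonym metric = "point \<Rightarrow> real^2^2"
type_synonym covec = "point \<Rightarrow> real^2"

primrec Ck_on :: "nat \<Rightarrow> 'a::real_normed_vector set \<Rightarrow> ('a \<Rightarrow> 'b::real_normed_vector) \<Rightarrow> bool" where
  "Ck_on 0 X f \<longleftrightarrow> continuous_on X f"
| "Ck_on (Suc r) X f \<longleftrightarrow>
     (\<forall>x\<in>X. f differentiable (at x)) \<and> (\<forall>v. Ck_on r X (\<lambda>x. frechet_derivative f (at x) v))"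

text \<open>Only used on open sets \<open>X\<close> of finite-dimensional spaces, where it is ordinary smoothness.\<close>

definition smooth_on :: "'a::real_normed_vector set \<Rightarrow> ('a \<Rightarrow> 'b::real_normed_vector) \<Rightarrow> bool" where
  "smooth_on X f \<longleftrightarrow> (\<forall>r. Ck_on r X f)"

definition pd :: "idx \<Rightarrow> (point \<Rightarrow> real) \<Rightarrow> point \<Rightarrow> real" where
  "pd i f x = frechet_derivative f (at x) (axis i 1)"

definition riemannian_metric_on :: "point set \<Rightarrow> metric \<Rightarrow> bool" where
  "riemannian_metric_on U a \<longleftrightarrow>
     (\<forall>i j. smooth_on U (\<lambda>x. a x $ i $ j)) \<and>
     (\<forall>x\<in>U. (\<forall>i j. a x $ i $ j = a x $ j $ i) \<and>
            (\<forall>y. y \<noteq> 0 \<longrightarrow> (\<Sum>i\<in>UNIV. \<Sum>j\<in>UNIV. a x $ i $ j * y $ i * y $ j) > 0))"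

definition smooth_covector_field_on :: "point set \<Rightarrow> covec \<Rightarrow> bool" where
  "smooth_covector_field_on U w \<longleftrightarrow> (\<forall>i. smooth_on U (\<lambda>x. w x $ i))"

definition ainv :: "metric \<Rightarrow> point \<Rightarrow> idx \<Rightarrow> idx \<Rightarrow> real" where
  "ainv a x i j = matrix_inv (a x) $ i $ j"

definition raise :: "metric \<Rightarrow> covec \<Rightarrow> point \<Rightarrow> real^2" where
  "raise a w x = (\<chi> i. \<Sum>j\<in>UNIV. ainv a x i j * w x $ j)"

definition cinner :: "metric \<Rightarrow> covec \<Rightarrow> covec \<Rightarrow> point \<Rightarrow> real" where
  "cinner a v w x = (\<Sum>i\<in>UNIV. \<Sum>j\<in>UNIV. ainv a x i j * v x $ i * w x $ j)"

definition christoffel :: "metric \<Rightarrow> idx \<Rightarrow> idx \<Rightarrow> idx \<Rightarrow> point \<Rightarrow> real" where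
  "christoffel a k n h x =
     (\<Sum>j\<in>UNIV. ainv a x k j *
        (pd n (\<lambda>z. a z $ j $ h) x + pd h (\<lambda>z. a z $ j $ n) x - pd j (\<lambda>z. a z $ n $ h) x)) / 2"

definition cov_deriv :: "metric \<Rightarrow> idx \<Rightarrow> covec \<Rightarrow> idx \<Rightarrow> point \<Rightarrow> real" where
  "cov_deriv a n w h x =
     pd n (\<lambda>z. w z $ h) x - (\<Sum>k\<in>UNIV. christoffel a k n h x * w x $ k)"

definition gam :: "idx \<Rightarrow> idx \<Rightarrow> real" where
  "gam i j = (if i = 1 \<and> j = 2 then 1 else if i = 2 \<and> j = 1 then - 1 else 0)"

definition eps :: "metric \<Rightarrow> point \<Rightarrow> idx \<Rightarrow> idx \<Rightarrow> real" where
  "eps a x j h = sqrt (det (a x)) * gam j h"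

definition oriented_orthonormal_on :: "point set \<Rightarrow> metric \<Rightarrow> covec \<Rightarrow> covec \<Rightarrow> bool" where
  "oriented_orthonormal_on U a b n \<longleftrightarrow>
     smooth_covector_field_on U b \<and> smooth_covector_field_on U n \<and>
     (\<forall>x\<in>U. cinner a b b x = 1 \<and> cinner a n n x = 1 \<and> cinner a b n x = 0 \<and>
            (\<forall>i j. eps a x i j = b x $ i * n x $ j - n x $ i * b x $ j))"

definition S :: "metric \<Rightarrow> point \<Rightarrow> real^2 \<Rightarrow> real" where
  "S a x y = sqrt (\<Sum>i\<in>UNIV. \<Sum>j\<in>UNIV. a x $ i $ j * y $ i * y $ j)"

definition m_low :: "metric \<Rightarrow> point \<Rightarrow> real^2 \<Rightarrow> idx \<Rightarrow> real" where
  "m_low a x y i = - (\<Sum>k\<in>UNIV. eps a x i k * (y $ k / S a x y))"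

definition m_up :: "metric \<Rightarrow> point \<Rightarrow> real^2 \<Rightarrow> idx \<Rightarrow> real" where
  "m_up a x y i = (\<Sum>j\<in>UNIV. ainv a x i j * m_low a x y j)"

text \<open>
  An open set of nonzero tangent vectors over \<open>U\<close> whose fibre over every point is a connected cone.
  Connectedness is required fibrewise: on a fibre with several components the conditions on the
  angle function below would leave it undetermined off the component of \<open>b\<close>.
\<close>

definition conic_region_over :: "point set \<Rightarrow> (point \<times> (real^2)) set \<Rightarrow> bool" where
  "conic_region_over U W \<longleftrightarrow>
     open W \<and> (\<forall>(x, y)\<in>W. x \<in> U \<and> y \<noteq> 0) \<and>
     (\<forall>x y c. (x, y) \<in> W \<longrightarrow> c > 0 \<longrightarrow> (x, c *\<^sub>R y) \<in> W) \<and>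
     (\<forall>x\<in>U. connected {y. (x, y) \<in> W})"

definition angle_function ::
  "point set \<Rightarrow> (point \<times> (real^2)) set \<Rightarrow> metric \<Rightarrow> covec \<Rightarrow> (point \<Rightarrow> real^2 \<Rightarrow> real) \<Rightarrow> bool" where
  "angle_function U W a b \<theta> \<longleftrightarrow>
     conic_region_over U W \<and> (\<forall>x\<in>U. (x, raise a b x) \<in> W) \<and>
     smooth_on W (\<lambda>(x, y). \<theta> x y) \<and>
     (\<forall>(x, y)\<in>W. \<forall>c>0. \<theta> x (c *\<^sub>R y) = \<theta> x y) \<and>
     (\<forall>(x, y)\<in>W. \<forall>n. S a x y * pd n (\<theta> x) y = m_low a x y n) \<and>
     (\<forall>x\<in>U. \<theta> x (raise a b x) = 0)"

definition L :: "metric \<Rightarrow> (point \<Rightarrow> real^2 \<Rightarrow> real) \<Rightarrow> covec \<Rightarrow> idx \<Rightarrow> idx \<Rightarrow> point \<Rightarrow> real^2 \<Rightarrow> real" where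
  "L a \<theta> kf k n x y =
     - (y $ k / S a x y) * pd n (\<lambda>z. S a z y) x
     - S a x y * m_up a x y k * (pd n (\<lambda>z. \<theta> z y) x - kf x $ n)"

definition n_nabla_b :: "metric \<Rightarrow> covec \<Rightarrow> covec \<Rightarrow> idx \<Rightarrow> point \<Rightarrow> real" where
  "n_nabla_b a b nf n x = (\<Sum>h\<in>UNIV. raise a nf x $ h * cov_deriv a n b h x)"

definition T :: "metric \<Rightarrow> covec \<Rightarrow> covec \<Rightarrow> covec \<Rightarrow> idx \<Rightarrow> point \<Rightarrow> real" where
  "T a b nf kf n x = n_nabla_b a b nf n x + kf x $ n"

definition Lcoef :: "metric \<Rightarrow> covec \<Rightarrow> covec \<Rightarrow> covec \<Rightarrow> idx \<Rightarrow> idx \<Rightarrow> idx \<Rightarrow> point \<Rightarrow> real" where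
  "Lcoef a b nf kf k n h x =
     - (\<Sum>j\<in>UNIV. ainv a x k j * eps a x j h) * T a b nf kf n x - christoffel a k n h x"

definition Lbar :: "metric \<Rightarrow> covec \<Rightarrow> covec \<Rightarrow> covec \<Rightarrow> idx \<Rightarrow> idx \<Rightarrow> idx \<Rightarrow> point \<Rightarrow> real" where
  "Lbar a b nf kf k n h x = - Lcoef a b nf kf k n h x"

text \<open>
  \<open>curvature G k n i j\<close> has \<open>k\<close> as its first lower and \<open>n\<close> as its upper index; the first argument of
  the coefficients \<open>G\<close> is the upper index.
\<close>

definition curvature ::
  "(idx \<Rightarrow> idx \<Rightarrow> idx \<Rightarrow> point \<Rightarrow> real) \<Rightarrow> idx \<Rightarrow> idx \<Rightarrow> idx \<Rightarrow> idx \<Rightarrow> point \<Rightarrow> real" where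
  "curvature G k n i j x =
     pd i (G n j k) x - pd j (G n i k) x
     + (\<Sum>m\<in>UNIV. G m j k x * G n i m x) - (\<Sum>m\<in>UNIV. G m i k x * G n j m x)"

definition riemann_curvature :: "metric \<Rightarrow> idx \<Rightarrow> idx \<Rightarrow> idx \<Rightarrow> idx \<Rightarrow> point \<Rightarrow> real" where
  "riemann_curvature a = curvature (christoffel a)"

end

theory Submission
  imports Defs
begin

text \<open>
  Everything becomes transparent when it is measured against the orthonormal coframe
  \<open>e\<^sub>1 = b\<close>, \<open>e\<^sub>2 = n\<close> instead of the coordinates.  The connection form of the
  Levi-Civita connection in this coframe is \<open>\<omega>\<^sub>n = n\<^sup>h \<nabla>\<^sub>n b\<^sub>h\<close>: metric compatibility gives
  \<open>\<nabla>\<^sub>n b\<^sub>h = \<omega>\<^sub>n n\<^sub>h\<close> and \<open>\<nabla>\<^sub>n n\<^sub>h = - \<omega>\<^sub>n b\<^sub>h\<close> (\<open>nabla_coframe\<close>).  Since the tensor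
  \<open>a\<^sup>k\<^sup>j \<epsilon>\<^sub>j\<^sub>h\<close> is the infinitesimal rotation \<open>b\<^sup>k n\<^sub>h - n\<^sup>k b\<^sub>h\<close>, adding \<open>\<omega>\<^sub>n\<close> times it to the
  Christoffel symbols cancels the connection form completely, and what remains is the flat connection
  for which the coframe is parallel, plus \<open>k\<^sub>n\<close> times the rotation.  This is the content of the structure
  equations (\<open>structure_equations\<close>)

    \<open>b\<^sub>k Lbar\<^sup>k\<^sub>n\<^sub>h = \<partial>\<^sub>n b\<^sub>h + k\<^sub>n n\<^sub>h\<close>,   \<open>n\<^sub>k Lbar\<^sup>k\<^sub>n\<^sub>h = \<partial>\<^sub>n n\<^sub>h - k\<^sub>n b\<^sub>h\<close>,

  in which neither the Christoffel symbols nor \<open>\<omega>\<close> occur any more.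

  Curvature: differentiating the structure equations once expresses the coframe components of the curvature
  through \<open>k\<close> and the coframe.  Second derivatives of the coframe cancel by symmetry, terms quadratic in
  \<open>k\<close> cancel because rotations of the plane commute, and only the curl of \<open>k\<close> survives
  (\<open>curvature_Lbar\<close>).

  The coefficients \<open>L\<close>: the angle function is the polar angle of \<open>y\<close> in the coframe, that is
  \<open>b(y) = S cos \<theta>\<close> and \<open>n(y) = S sin \<theta>\<close> (\<open>angle_polar\<close>); the prescribed vertical derivatives of \<open>\<theta>\<close> are
  those of the polar angle, the fibre is connected, and the two angles agree at \<open>y = b\<close>.  Differentiating these identities in \<open>x\<close> with
  \<open>y\<close> fixed gives \<open>\<partial>\<^sub>n S\<close> and \<open>S \<partial>\<^sub>n \<theta>\<close> as combinations of \<open>\<partial>\<^sub>n b(y)\<close> and \<open>\<partial>\<^sub>n n(y)\<close>, and the components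
  of \<open>L\<close> along \<open>b\<close> and \<open>n\<close> turn into the right-hand sides of the structure equations contracted
  with \<open>- y\<^sup>h\<close> (\<open>L_eq_Lcoef\<close>).

  Finally \<open>Lbar\<close> equals the Christoffel symbols exactly when the rotation term, whose factor is
  \<open>\<omega>\<^sub>n + k\<^sub>n\<close>, vanishes; as this holds on the open set \<open>U\<close>, the curvatures agree as well.
\<close>

section \<open>Symmetry of second derivatives\<close>

text \<open>
  The mean value theorem, applied first in the direction \<open>u\<close> and then in the direction \<open>v\<close>, turns the second
  difference over a small parallelogram into a mixed derivative at some point of it.  The second difference does not
  change when \<open>u\<close> and \<open>v\<close> are exchanged, which is what makes mixed derivatives symmetric.
\<close>

lemma second_difference_mvt:
  fixes f :: "'a::real_normed_vector \<Rightarrow> real"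
  assumes f: "\<And>p. p \<in> X \<Longrightarrow> f differentiable (at p)"
    and Df: "\<And>p. p \<in> X \<Longrightarrow> (\<lambda>p. frechet_derivative f (at p) u) differentiable (at p)"
    and h: "0 < h"
    and X: "\<And>r q. 0 \<le> r \<Longrightarrow> r \<le> h \<Longrightarrow> 0 \<le> q \<Longrightarrow> q \<le> h \<Longrightarrow> x + r *\<^sub>R u + q *\<^sub>R v \<in> X"
  shows "\<exists>r q. 0 \<le> r \<and> r \<le> h \<and> 0 \<le> q \<and> q \<le> h \<and>
    f (x + h *\<^sub>R u + h *\<^sub>R v) - f (x + h *\<^sub>R u) - f (x + h *\<^sub>R v) + f x =
    h * h * frechet_derivative (\<lambda>p. frechet_derivative f (at p) u) (at (x + r *\<^sub>R u + q *\<^sub>R v)) v"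
proof -
  have along: "((\<lambda>r. g (c + r *\<^sub>R w)) has_real_derivative frechet_derivative g (at (c + r *\<^sub>R w)) w) (at r)"
    if "g differentiable (at (c + r *\<^sub>R w))" for g :: "'a \<Rightarrow> real" and c w r
  proof -
    have g: "(g has_derivative frechet_derivative g (at (c + r *\<^sub>R w))) (at (c + r *\<^sub>R w))"
      using that frechet_derivative_works by blast
    have l: "((\<lambda>r. c + r *\<^sub>R w) has_derivative (\<lambda>t. t *\<^sub>R w)) (at r)"
      by (auto intro!: derivative_eq_intros)
    have "((\<lambda>r. g (c + r *\<^sub>R w)) has_derivative (\<lambda>t. frechet_derivative g (at (c + r *\<^sub>R w)) (t *\<^sub>R w))) (at r)"
      using has_derivative_compose[OF l g] by simp
    moreover have "frechet_derivative g (at (c + r *\<^sub>R w)) (t *\<^sub>R w)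
        = t * frechet_derivative g (at (c + r *\<^sub>R w)) w" for t
      using linear_scale[OF linear_frechet_derivative[OF that]] by simp
    ultimately show ?thesis
      by (simp add: has_field_derivative_def mult.commute[of _ "frechet_derivative g _ w"] mult_commute_abs)
  qed
  let ?D = "\<lambda>p. frechet_derivative f (at p) u"
  have "\<exists>r>0. r < h \<and> (\<lambda>r. f (x + h *\<^sub>R v + r *\<^sub>R u) - f (x + r *\<^sub>R u)) h
      - (\<lambda>r. f (x + h *\<^sub>R v + r *\<^sub>R u) - f (x + r *\<^sub>R u)) 0
      = (h - 0) * (?D (x + h *\<^sub>R v + r *\<^sub>R u) - ?D (x + r *\<^sub>R u))"
  proof (rule MVT2[OF h])
    fix r assume r: "0 \<le> r" "r \<le> h"
    have "x + h *\<^sub>R v + r *\<^sub>R u \<in> X" "x + r *\<^sub>R u \<in> X"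
      using X[of r h] X[of r 0] r h by (simp_all add: algebra_simps)
    then show "DERIV (\<lambda>r. f (x + h *\<^sub>R v + r *\<^sub>R u) - f (x + r *\<^sub>R u)) r :>
        ?D (x + h *\<^sub>R v + r *\<^sub>R u) - ?D (x + r *\<^sub>R u)"
      by (intro DERIV_diff along f)
  qed
  then obtain r where r: "0 < r" "r < h" and 1:
    "f (x + h *\<^sub>R v + h *\<^sub>R u) - f (x + h *\<^sub>R u) - f (x + h *\<^sub>R v) + f x =
     h * (?D (x + h *\<^sub>R v + r *\<^sub>R u) - ?D (x + r *\<^sub>R u))"
    by auto
  have "\<exists>q>0. q < h \<and> ?D (x + r *\<^sub>R u + h *\<^sub>R v) - ?D (x + r *\<^sub>R u + 0 *\<^sub>R v)
      = (h - 0) * frechet_derivative ?D (at (x + r *\<^sub>R u + q *\<^sub>R v)) v"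
    by (rule MVT2[OF h]) (use r in \<open>intro along Df X; simp\<close>)
  then obtain q where q: "0 < q" "q < h" and 2:
    "?D (x + r *\<^sub>R u + h *\<^sub>R v) - ?D (x + r *\<^sub>R u)
      = h * frechet_derivative ?D (at (x + r *\<^sub>R u + q *\<^sub>R v)) v"
    by auto
  have swap: "x + h *\<^sub>R v + s *\<^sub>R u = x + s *\<^sub>R u + h *\<^sub>R v" for s by simp
  show ?thesis
    using 1 2 r q unfolding swap
    by (intro exI[where x = r] exI[where x = q] conjI) auto
qed

lemma frechet_derivative_symmetric:
  fixes f :: "'a::real_normed_vector \<Rightarrow> real"
  assumes X: "open X" "x \<in> X" and f: "Ck_on (Suc (Suc 0)) X f"
  shows "frechet_derivative (\<lambda>p. frechet_derivative f (at p) u) (at x) v =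
    frechet_derivative (\<lambda>p. frechet_derivative f (at p) v) (at x) u"
proof (rule ccontr)
  let ?F = "\<lambda>u v p. frechet_derivative (\<lambda>p. frechet_derivative f (at p) u) (at p) v"
  assume ne: "\<not> ?thesis"
  define e where "e = \<bar>?F u v x - ?F v u x\<bar> / 2"
  have e: "e > 0" using ne by (simp add: e_def)
  have "isCont (?F u v) x" "isCont (?F v u) x"
    using f X by (auto simp: continuous_on_eq_continuous_at)
  then obtain d1 d2 where d: "d1 > 0" "d2 > 0"
    and d1: "\<And>p. dist p x < d1 \<Longrightarrow> \<bar>?F u v p - ?F u v x\<bar> < e"
    and d2: "\<And>p. dist p x < d2 \<Longrightarrow> \<bar>?F v u p - ?F v u x\<bar> < e"
    using e unfolding continuous_at_eps_delta dist_real_def by metis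
  obtain d3 where d3: "d3 > 0" "ball x d3 \<subseteq> X"
    using X open_contains_ball by blast
  define d where "d = min d1 (min d2 d3)"
  define N where "N = norm u + norm v + 1"
  define h where "h = d / (2 * N)"
  have n: "N > 0"
    using norm_ge_zero[of u] norm_ge_zero[of v] unfolding N_def by linarith
  have h: "h > 0" using d d3 n by (simp add: h_def d_def)
  have near: "dist (x + r *\<^sub>R u + q *\<^sub>R v) x < d" "dist (x + q *\<^sub>R v + r *\<^sub>R u) x < d"
    if "0 \<le> r" "r \<le> h" "0 \<le> q" "q \<le> h" for r q
  proof -
    have "norm (r *\<^sub>R u + q *\<^sub>R v) \<le> r * norm u + q * norm v"
      using norm_triangle_ineq[of "r *\<^sub>R u" "q *\<^sub>R v"] that by simp
    also have "\<dots> \<le> h * norm u + h * norm v"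
      using that by (intro add_mono mult_right_mono) auto
    also have "\<dots> < 2 * (h * N)"
      using mult_pos_pos[OF h n] h by (simp add: N_def algebra_simps)
    also have "\<dots> = d" using n by (simp add: h_def)
    finally show "dist (x + r *\<^sub>R u + q *\<^sub>R v) x < d" "dist (x + q *\<^sub>R v + r *\<^sub>R u) x < d"
      by (simp_all add: dist_norm algebra_simps)
  qed
  have inX: "x + r *\<^sub>R u + q *\<^sub>R v \<in> X" "x + q *\<^sub>R v + r *\<^sub>R u \<in> X"
    if "0 \<le> r" "r \<le> h" "0 \<le> q" "q \<le> h" for r q
    using near[OF that] d3 by (auto simp: d_def subset_iff dist_commute)
  have df: "\<And>p. p \<in> X \<Longrightarrow> f differentiable (at p)"
    "\<And>p w. p \<in> X \<Longrightarrow> (\<lambda>p. frechet_derivative f (at p) w) differentiable (at p)"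
    using f by auto
  obtain r q where rq: "0 \<le> r" "r \<le> h" "0 \<le> q" "q \<le> h" and 1:
    "f (x + h *\<^sub>R u + h *\<^sub>R v) - f (x + h *\<^sub>R u) - f (x + h *\<^sub>R v) + f x
      = h * h * ?F u v (x + r *\<^sub>R u + q *\<^sub>R v)"
    using second_difference_mvt[OF df h inX(1)] by blast
  obtain r' q' where rq': "0 \<le> r'" "r' \<le> h" "0 \<le> q'" "q' \<le> h" and 2:
    "f (x + h *\<^sub>R v + h *\<^sub>R u) - f (x + h *\<^sub>R v) - f (x + h *\<^sub>R u) + f x
      = h * h * ?F v u (x + r' *\<^sub>R v + q' *\<^sub>R u)"
    using second_difference_mvt[of X f v h x u, OF df h] inX(2) by blast
  have "f (x + h *\<^sub>R v + h *\<^sub>R u) = f (x + h *\<^sub>R u + h *\<^sub>R v)"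
    by (rule arg_cong[where f = f]) simp
  with 1 2 have "h * h * ?F u v (x + r *\<^sub>R u + q *\<^sub>R v) = h * h * ?F v u (x + r' *\<^sub>R v + q' *\<^sub>R u)"
    by linarith
  then have "?F u v (x + r *\<^sub>R u + q *\<^sub>R v) = ?F v u (x + r' *\<^sub>R v + q' *\<^sub>R u)"
    using h by simp
  moreover have "\<bar>?F u v (x + r *\<^sub>R u + q *\<^sub>R v) - ?F u v x\<bar> < e"
    using d1 near(1)[OF rq] by (simp add: d_def)
  moreover have "\<bar>?F v u (x + r' *\<^sub>R v + q' *\<^sub>R u) - ?F v u x\<bar> < e"
    using d2 near(2)[OF rq'(3,4,1,2)] by (simp add: d_def)
  ultimately show False
    unfolding e_def by argo
qed

section \<open>Partial derivatives of smooth functions\<close>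

lemma pd_eqI: "(f has_derivative f') (at x) \<Longrightarrow> pd i f x = f' (axis i 1)"
  unfolding pd_def using frechet_derivative_at by metis

text \<open>
  Many identities below hold only on an open set of points; this is how they are differentiated.
\<close>

lemma pd_cong_open:
  assumes "open X" "x \<in> X" "\<And>z. z \<in> X \<Longrightarrow> f z = g z"
  shows "pd i f x = pd i g x"
proof -
  have "(f has_derivative D) (at x) \<longleftrightarrow> (g has_derivative D) (at x)" for D
    using assms has_derivative_transform_within_open[of f D x UNIV X g]
      has_derivative_transform_within_open[of g D x UNIV X f] by auto
  then show ?thesis
    unfolding pd_def frechet_derivative_def by simp
qed

lemma pd_add:
  assumes "f differentiable (at x)" "g differentiable (at x)"
  shows "pd i (\<lambda>z. f z + g z) x = pd i f x + pd i g x"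
  using pd_eqI[OF has_derivative_add[OF assms[unfolded frechet_derivative_works]]]
  by (simp add: pd_def)

lemma pd_mult:
  assumes "f differentiable (at x)" "g differentiable (at x)"
  shows "pd i (\<lambda>z. f z * g z) x = pd i f x * g x + f x * pd i g x"
  using pd_eqI[OF has_derivative_mult[OF assms[unfolded frechet_derivative_works]]]
  by (simp add: pd_def)

lemma pd_const: "pd i (\<lambda>z. c) x = 0"
  by (simp add: pd_def)

lemma pd_chain:
  fixes f :: "point \<Rightarrow> real" and g :: "real \<Rightarrow> real"
  assumes "f differentiable (at x)" "(g has_real_derivative g') (at (f x))"
  shows "pd i (\<lambda>z. g (f z)) x = g' * pd i f x"
  using pd_eqI[OF has_derivative_compose[OF assms(1)[unfolded frechet_derivative_works]
    assms(2)[unfolded has_field_derivative_def]]]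
  by (simp add: pd_def)

lemma frechet_derivative_eq_pd:
  assumes "f differentiable (at x)"
  shows "frechet_derivative f (at x) v = (\<Sum>i\<in>UNIV. v $ i * pd i f x)"
proof -
  interpret linear "frechet_derivative f (at x)"
    by (rule linear_frechet_derivative[OF assms])
  have "v = (\<Sum>i\<in>UNIV. (v $ i) *\<^sub>R axis i 1)"
    using basis_expansion[of v] by (simp add: scalar_mult_eq_scaleR)
  then have "frechet_derivative f (at x) v = frechet_derivative f (at x) (\<Sum>i\<in>UNIV. (v $ i) *\<^sub>R axis i 1)"
    by simp
  also have "\<dots> = (\<Sum>i\<in>UNIV. v $ i * pd i f x)"
    by (simp add: sum scale pd_def)
  finally show ?thesis .
qed

lemma smooth_on_differentiable: "smooth_on X f \<Longrightarrow> x \<in> X \<Longrightarrow> f differentiable (at x)"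
  unfolding smooth_on_def using Ck_on.simps(2)[of 0 X f] by blast

lemma smooth_on_pd_differentiable:
  "smooth_on X f \<Longrightarrow> x \<in> X \<Longrightarrow> pd i f differentiable (at x)"
  unfolding smooth_on_def pd_def[abs_def] using Ck_on.simps(2)[of "Suc 0" X f] Ck_on.simps(2)[of 0] by blast

lemma smooth_on_pd_commute:
  assumes "smooth_on X f" "open X" "x \<in> X"
  shows "pd i (pd j f) x = pd j (pd i f) x"
  using frechet_derivative_symmetric[of X x f "axis j 1" "axis i 1"] assms
  unfolding smooth_on_def pd_def[abs_def] by blast

section \<open>Polar angle\<close>

text \<open>
  The hypothesis on \<open>\<theta>\<close> says that its differential is the pullback of the winding form of the punctured plane under \<open>(C, D)\<close>.
  Rotating \<open>(C, D)\<close> back by the angle \<open>\<theta>\<close> and normalizing therefore gives a pair \<open>(p, q)\<close> of constant functions, whose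
  value at \<open>y0\<close> is \<open>(1, 0)\<close>.
\<close>

lemma polar_angle_unique:
  fixes C D \<theta> :: "'a::real_normed_vector \<Rightarrow> real"
  assumes X: "open X" "connected X"
    and C: "\<And>y. y \<in> X \<Longrightarrow> (C has_derivative C' y) (at y)"
    and D: "\<And>y. y \<in> X \<Longrightarrow> (D has_derivative D' y) (at y)"
    and pos: "\<And>y. y \<in> X \<Longrightarrow> (C y)\<^sup>2 + (D y)\<^sup>2 > 0"
    and \<theta>: "\<And>y. y \<in> X \<Longrightarrow>
      (\<theta> has_derivative (\<lambda>v. (C y * D' y v - D y * C' y v) / ((C y)\<^sup>2 + (D y)\<^sup>2))) (at y)"
    and y0: "y0 \<in> X" "C y0 > 0" "D y0 = 0" "\<theta> y0 = 0" and y: "y \<in> X"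
  shows "C y = sqrt ((C y)\<^sup>2 + (D y)\<^sup>2) * cos (\<theta> y)"
    and "D y = sqrt ((C y)\<^sup>2 + (D y)\<^sup>2) * sin (\<theta> y)"
proof -
  define r where "r y = sqrt ((C y)\<^sup>2 + (D y)\<^sup>2)" for y
  define p where "p y = (C y * cos (\<theta> y) + D y * sin (\<theta> y)) / r y" for y
  define q where "q y = (D y * cos (\<theta> y) - C y * sin (\<theta> y)) / r y" for y
  have r: "r y > 0" "(C y)\<^sup>2 = (r y)\<^sup>2 - (D y)\<^sup>2" if "y \<in> X" for y
    using pos[OF that] by (simp_all add: r_def)
  have r': "(r has_derivative (\<lambda>v. (C y * C' y v + D y * D' y v) / r y)) (at y)" if "y \<in> X" for y
  proof -
    have "((\<lambda>y. (C y)\<^sup>2 + (D y)\<^sup>2) has_derivative (\<lambda>v. 2 * (C y * C' y v + D y * D' y v))) (at y)"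
      by (rule has_derivative_eq_rhs, (rule derivative_intros C[OF that] D[OF that])+)
        (simp add: fun_eq_iff algebra_simps)
    from has_derivative_compose[OF this DERIV_real_sqrt[OF pos[OF that], unfolded has_field_derivative_def]]
    have "(r has_derivative (\<lambda>v. inverse (r y) / 2 * (2 * (C y * C' y v + D y * D' y v)))) (at y)"
      unfolding r_def[abs_def] .
    moreover have "inverse \<rho> / 2 * (2 * t) = t / \<rho>" for \<rho> t :: real
      by (simp add: inverse_eq_divide)
    ultimately show ?thesis by (simp only:)
  qed
  have \<theta>': "(\<theta> has_derivative (\<lambda>v. (C y * D' y v - D y * C' y v) / (r y)\<^sup>2)) (at y)" if "y \<in> X" for y
    using \<theta>[OF that] pos[OF that] by (simp add: r_def)
  have quot: "(n * \<rho> - m * (e / \<rho>)) / (\<rho> * \<rho>) = 0" if "n * \<rho>\<^sup>2 = m * e" "\<rho> > 0" for n m e \<rho> :: real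
    using that by (simp add: field_simps power2_eq_square)
  have p': "(p has_derivative (\<lambda>v. 0)) (at y)" if y: "y \<in> X" for y
  proof -
    have *: "((C' y v * cos (\<theta> y) + C y * (- sin (\<theta> y) * t) + (D' y v * sin (\<theta> y) + D y * (cos (\<theta> y) * t))) * r y
        - (C y * cos (\<theta> y) + D y * sin (\<theta> y)) * (E / r y)) / (r y * r y) = 0"
      if "t = (C y * D' y v - D y * C' y v) / (r y)\<^sup>2" "E = C y * C' y v + D y * D' y v" for v t E
    proof -
      have t: "t * (r y)\<^sup>2 = C y * D' y v - D y * C' y v" using that r[OF y] by simp
      have R: "(r y)\<^sup>2 = (C y)\<^sup>2 + (D y)\<^sup>2" using r(2)[OF y] by simp
      have "(C' y v * cos (\<theta> y) + C y * (- sin (\<theta> y) * t) + (D' y v * sin (\<theta> y) + D y * (cos (\<theta> y) * t))) * (r y)\<^sup>2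
        = (C' y v * cos (\<theta> y) + D' y v * sin (\<theta> y)) * (r y)\<^sup>2 + (D y * cos (\<theta> y) - C y * sin (\<theta> y)) * (t * (r y)\<^sup>2)"
        by (simp add: algebra_simps)
      also have "\<dots> = (C y * cos (\<theta> y) + D y * sin (\<theta> y)) * E"
        unfolding t unfolding R that(2) by (simp add: algebra_simps power2_eq_square)
      finally have "(C' y v * cos (\<theta> y) + C y * (- sin (\<theta> y) * t) + (D' y v * sin (\<theta> y) + D y * (cos (\<theta> y) * t))) * (r y)\<^sup>2
        = (C y * cos (\<theta> y) + D y * sin (\<theta> y)) * E" .
      then show ?thesis using r(1)[OF y] by (rule quot)
    qed
    show ?thesis unfolding p_def[abs_def]
      apply (rule has_derivative_eq_rhs)
       apply (rule has_derivative_divide' has_derivative_add has_derivative_mult has_derivative_cos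
           has_derivative_sin C D r' \<theta>' y)+
      using r(1)[OF y] apply simp
      apply (rule ext)
      subgoal for v using *[OF refl refl, of v] by (simp add: algebra_simps)
      done
  qed
  have q': "(q has_derivative (\<lambda>v. 0)) (at y)" if y: "y \<in> X" for y
  proof -
    have *: "((D' y v * cos (\<theta> y) + D y * (- sin (\<theta> y) * t) - (C' y v * sin (\<theta> y) + C y * (cos (\<theta> y) * t))) * r y
        - (D y * cos (\<theta> y) - C y * sin (\<theta> y)) * (E / r y)) / (r y * r y) = 0"
      if "t = (C y * D' y v - D y * C' y v) / (r y)\<^sup>2" "E = C y * C' y v + D y * D' y v" for v t E
    proof -
      have t: "t * (r y)\<^sup>2 = C y * D' y v - D y * C' y v" using that r[OF y] by simp
      have R: "(r y)\<^sup>2 = (C y)\<^sup>2 + (D y)\<^sup>2" using r(2)[OF y] by simp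
      have "(D' y v * cos (\<theta> y) + D y * (- sin (\<theta> y) * t) - (C' y v * sin (\<theta> y) + C y * (cos (\<theta> y) * t))) * (r y)\<^sup>2
        = (D' y v * cos (\<theta> y) - C' y v * sin (\<theta> y)) * (r y)\<^sup>2 - (C y * cos (\<theta> y) + D y * sin (\<theta> y)) * (t * (r y)\<^sup>2)"
        by (simp add: algebra_simps)
      also have "\<dots> = (D y * cos (\<theta> y) - C y * sin (\<theta> y)) * E"
        unfolding t unfolding R that(2) by (simp add: algebra_simps power2_eq_square)
      finally have "(D' y v * cos (\<theta> y) + D y * (- sin (\<theta> y) * t) - (C' y v * sin (\<theta> y) + C y * (cos (\<theta> y) * t))) * (r y)\<^sup>2
        = (D y * cos (\<theta> y) - C y * sin (\<theta> y)) * E" .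
      then show ?thesis using r(1)[OF y] by (rule quot)
    qed
    show ?thesis unfolding q_def[abs_def]
      apply (rule has_derivative_eq_rhs)
       apply (rule has_derivative_divide' has_derivative_diff has_derivative_mult has_derivative_cos
           has_derivative_sin C D r' \<theta>' y)+
      using r(1)[OF y] apply simp
      apply (rule ext)
      subgoal for v using *[OF refl refl, of v] by (simp add: algebra_simps)
      done
  qed
  have "p y = p y0" "q y = q y0"
    using has_derivative_zero_unique_connected[OF X p' y y0(1)]
      has_derivative_zero_unique_connected[OF X q' y y0(1)] by auto
  moreover have "r y0 = C y0" using y0 by (simp add: r_def)
  ultimately have "p y = 1" "q y = 0"
    using y0 by (simp_all add: p_def q_def)
  then have 1: "C y * cos (\<theta> y) + D y * sin (\<theta> y) = r y"
    and 2: "D y * cos (\<theta> y) - C y * sin (\<theta> y) = 0"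
    using r(1)[OF y] by (simp_all add: p_def q_def)
  have id: "(p * c + q * s) * c = p * (c\<^sup>2 + s\<^sup>2) + s * (q * c - p * s)"
    "(p * c + q * s) * s = q * (c\<^sup>2 + s\<^sup>2) - c * (q * c - p * s)" for p q c s :: real
    by (simp_all add: algebra_simps power2_eq_square)
  have "r y * cos (\<theta> y) = C y * 1 + sin (\<theta> y) * 0" "r y * sin (\<theta> y) = D y * 1 - cos (\<theta> y) * 0"
    unfolding 1[symmetric] id 2 by (simp_all only: sin_cos_squared_add2)
  then have e: "C y = r y * cos (\<theta> y)" "D y = r y * sin (\<theta> y)"
    by simp_all
  show "C y = sqrt ((C y)\<^sup>2 + (D y)\<^sup>2) * cos (\<theta> y)"
    using e(1) unfolding r_def .
  show "D y = sqrt ((C y)\<^sup>2 + (D y)\<^sup>2) * sin (\<theta> y)"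
    using e(2) unfolding r_def .
qed

section \<open>Orthonormal coframes\<close>

text \<open>
  If \<open>P\<close> has the covectors \<open>e\<close> and \<open>f\<close> as rows, orthonormality is \<open>P B P\<^sup>T = 1\<close>.  A one-sided inverse of a square matrix
  is two-sided, so \<open>B P\<^sup>T P = 1\<close> and \<open>A = P\<^sup>T P\<close>.
\<close>

lemma orthonormal_coframe_matrix:
  fixes A B :: "real^2^2" and e f :: "real^2"
  assumes sym: "\<And>i j. A $ i $ j = A $ j $ i" and AB: "A ** B = mat 1"
    and ee: "(\<Sum>i\<in>UNIV. \<Sum>j\<in>UNIV. B $ i $ j * e $ i * e $ j) = 1"
    and ff: "(\<Sum>i\<in>UNIV. \<Sum>j\<in>UNIV. B $ i $ j * f $ i * f $ j) = 1"
    and ef: "(\<Sum>i\<in>UNIV. \<Sum>j\<in>UNIV. B $ i $ j * e $ i * f $ j) = 0"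
  shows "B $ i $ j = B $ j $ i" and "A $ i $ j = e $ i * e $ j + f $ i * f $ j"
proof -
  have "transpose A = A" using sym by (simp add: transpose_def vec_eq_iff)
  then have "transpose B ** A = mat 1"
    using AB matrix_transpose_mul[of A B] by simp
  then have "transpose B = B"
    using AB matrix_mul_assoc[of "transpose B" A B] by simp
  then show Bsym: "B $ i $ j = B $ j $ i" for i j
  proof -
    have "B $ i $ j = transpose B $ i $ j" using \<open>transpose B = B\<close> by simp
    then show ?thesis by (simp add: transpose_def)
  qed
  define P :: "real^2^2" where "P = (\<chi> r. if r = 1 then e else f)"
  have "P ** (B ** transpose P) = mat 1"
    using ee ff ef Bsym[of 2 1]
    by (simp add: P_def matrix_matrix_mult_def transpose_def mat_def vec_eq_iff forall_2 sum_2 algebra_simps)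
  then have "(B ** transpose P) ** P = mat 1"
    using matrix_left_right_inverse by blast
  then have "A ** (B ** (transpose P ** P)) = A"
    by (simp add: matrix_mul_assoc)
  then have "transpose P ** P = A"
    by (simp add: matrix_mul_assoc AB)
  then have "A $ i $ j = (transpose P ** P) $ i $ j" by simp
  then show "A $ i $ j = e $ i * e $ j + f $ i * f $ j"
    by (simp add: P_def matrix_matrix_mult_def transpose_def sum_2)
qed

text \<open>
  Cramer's rule; the dual vectors \<open>u\<close> and \<open>w\<close> witness that the determinant of \<open>e\<close> and \<open>f\<close> is nonzero.
  The lemma reduces an identity of vectors to its two components in the coframe; it also applies with the
  roles of vectors and covectors exchanged.
\<close>

lemma eq_from_dual_pairings:
  fixes e f u w :: "real^2" and X Y :: "idx \<Rightarrow> real"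
  assumes dual: "e \<bullet> u = 1" "f \<bullet> u = 0" "e \<bullet> w = 0" "f \<bullet> w = 1"
    and "(\<Sum>k\<in>UNIV. e $ k * X k) = (\<Sum>k\<in>UNIV. e $ k * Y k)"
    and "(\<Sum>k\<in>UNIV. f $ k * X k) = (\<Sum>k\<in>UNIV. f $ k * Y k)"
  shows "X k = Y k"
proof -
  define D where "D = e $ 1 * f $ 2 - e $ 2 * f $ 1"
  have "D * (u $ 1 * w $ 2 - u $ 2 * w $ 1) = (e \<bullet> u) * (f \<bullet> w) - (f \<bullet> u) * (e \<bullet> w)"
    by (simp add: D_def inner_vec_def sum_2 algebra_simps)
  then have "D \<noteq> 0" using dual by auto
  have "D * Z 1 = f $ 2 * (\<Sum>k\<in>UNIV. e $ k * Z k) - e $ 2 * (\<Sum>k\<in>UNIV. f $ k * Z k)"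
    "D * Z 2 = e $ 1 * (\<Sum>k\<in>UNIV. f $ k * Z k) - f $ 1 * (\<Sum>k\<in>UNIV. e $ k * Z k)" for Z
    by (simp_all add: D_def sum_2 algebra_simps)
  then have "D * X 1 = D * Y 1" "D * X 2 = D * Y 2"
    using assms(5,6) by simp_all
  then show ?thesis using \<open>D \<noteq> 0\<close> exhaust_2[of k] by auto
qed

locale oriented_coframe =
  fixes U :: "point set" and a :: metric and b nf :: covec
  assumes open_U: "open U"
    and metric: "riemannian_metric_on U a"
    and orthonormal: "oriented_orthonormal_on U a b nf"
begin

abbreviation "bvec \<equiv> raise a b"
abbreviation "nvec \<equiv> raise a nf"

lemma smooth [intro]:
  "smooth_on U (\<lambda>z. a z $ i $ j)" "smooth_on U (\<lambda>z. b z $ i)" "smooth_on U (\<lambda>z. nf z $ i)"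
  using metric orthonormal
  unfolding riemannian_metric_on_def oriented_orthonormal_on_def smooth_covector_field_on_def by auto

lemma differentiable_coframe:
  assumes "x \<in> U"
  shows "(\<lambda>z. a z $ i $ j) differentiable (at x)"
    "(\<lambda>z. b z $ i) differentiable (at x)" "(\<lambda>z. nf z $ i) differentiable (at x)"
  using smooth_on_differentiable[OF _ assms] smooth by blast+

lemma
  assumes x: "x \<in> U"
  shows ainv_sym: "ainv a x i j = ainv a x j i"
    and metric_coframe: "a x $ i $ j = b x $ i * b x $ j + nf x $ i * nf x $ j"
proof -
  have sym: "a x $ i $ j = a x $ j $ i" for i j
    using metric x by (auto simp: riemannian_metric_on_def)
  have "y = 0" if "a x *v y = 0" for y
  proof (rule ccontr)
    assume "y \<noteq> 0"
    then have "(\<Sum>i\<in>UNIV. \<Sum>j\<in>UNIV. a x $ i $ j * y $ i * y $ j) > 0"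
      using metric x by (auto simp: riemannian_metric_on_def)
    also have "(\<Sum>i\<in>UNIV. \<Sum>j\<in>UNIV. a x $ i $ j * y $ i * y $ j) = y \<bullet> (a x *v y)"
      by (simp add: inner_vec_def matrix_vector_mult_def sum_2 algebra_simps)
    finally show False using that by simp
  qed
  then have "invertible (a x)"
    using matrix_left_invertible_ker[of "a x"] invertible_left_inverse[of "a x"] by blast
  then have AB: "a x ** matrix_inv (a x) = mat 1"
    using someI_ex[of "\<lambda>B. a x ** B = mat 1 \<and> B ** a x = mat 1"]
    unfolding matrix_inv_def invertible_def by blast
  note on = orthonormal[unfolded oriented_orthonormal_on_def cinner_def ainv_def]
  show "ainv a x i j = ainv a x j i" "a x $ i $ j = b x $ i * b x $ j + nf x $ i * nf x $ j"
    using orthonormal_coframe_matrix[OF sym AB, of "b x" "nf x"] on x by (auto simp: ainv_def)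
qed

lemma raise_pairing:
  assumes x: "x \<in> U"
  shows "b x \<bullet> bvec x = 1" "nf x \<bullet> bvec x = 0" "b x \<bullet> nvec x = 0" "nf x \<bullet> nvec x = 1"
  using orthonormal x ainv_sym[OF x, of 2 1]
  unfolding oriented_orthonormal_on_def cinner_def raise_def
  by (auto simp: inner_vec_def sum_2 algebra_simps)

lemma eps_coframe:
  "x \<in> U \<Longrightarrow> eps a x i j = b x $ i * nf x $ j - nf x $ i * b x $ j"
  using orthonormal unfolding oriented_orthonormal_on_def by blast

lemma raise_contract:
  assumes x: "x \<in> U"
  shows "(\<Sum>k\<in>UNIV. w x $ k * (\<Sum>j\<in>UNIV. ainv a x k j * X j)) = (\<Sum>j\<in>UNIV. raise a w x $ j * X j)"
  using ainv_sym[OF x, of 2 1] by (simp add: raise_def sum_2 algebra_simps)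

text \<open>
  Raising an index of \<open>\<epsilon>\<close> gives the quarter turn, which maps \<open>b\<close> to \<open>n\<close> and \<open>n\<close> to \<open>- b\<close>.
\<close>

lemma eps_contract:
  assumes x: "x \<in> U"
  shows "(\<Sum>k\<in>UNIV. b x $ k * (\<Sum>j\<in>UNIV. ainv a x k j * eps a x j h)) = nf x $ h"
    and "(\<Sum>k\<in>UNIV. nf x $ k * (\<Sum>j\<in>UNIV. ainv a x k j * eps a x j h)) = - b x $ h"
proof -
  have "(\<Sum>j\<in>UNIV. raise a w x $ j * eps a x j h) = (b x \<bullet> raise a w x) * nf x $ h - (nf x \<bullet> raise a w x) * b x $ h" for w
    by (simp add: eps_coframe[OF x] inner_vec_def sum_2 algebra_simps)
  then show "(\<Sum>k\<in>UNIV. b x $ k * (\<Sum>j\<in>UNIV. ainv a x k j * eps a x j h)) = nf x $ h"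
    "(\<Sum>k\<in>UNIV. nf x $ k * (\<Sum>j\<in>UNIV. ainv a x k j * eps a x j h)) = - b x $ h"
    using raise_pairing[OF x]
      raise_contract[OF x, of b "\<lambda>j. eps a x j h"] raise_contract[OF x, of nf "\<lambda>j. eps a x j h"] by simp_all
qed

lemma pd_metric:
  assumes x: "x \<in> U"
  shows "pd n (\<lambda>z. a z $ i $ j) x =
    pd n (\<lambda>z. b z $ i) x * b x $ j + b x $ i * pd n (\<lambda>z. b z $ j) x +
    (pd n (\<lambda>z. nf z $ i) x * nf x $ j + nf x $ i * pd n (\<lambda>z. nf z $ j) x)"
proof -
  have "pd n (\<lambda>z. a z $ i $ j) x = pd n (\<lambda>z. b z $ i * b z $ j + nf z $ i * nf z $ j) x"
    by (rule pd_cong_open[OF open_U x]) (rule metric_coframe)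
  then show ?thesis
    using differentiable_coframe[OF x] by (simp add: pd_add pd_mult)
qed

lemma christoffel_contract:
  assumes x: "x \<in> U"
  shows "(\<Sum>k\<in>UNIV. w x $ k * christoffel a k n h x) = (\<Sum>j\<in>UNIV. raise a w x $ j *
    ((pd n (\<lambda>z. a z $ j $ h) x + pd h (\<lambda>z. a z $ j $ n) x - pd j (\<lambda>z. a z $ n $ h) x) / 2))"
proof -
  have "christoffel a k n h x = (\<Sum>j\<in>UNIV. ainv a x k j *
    ((pd n (\<lambda>z. a z $ j $ h) x + pd h (\<lambda>z. a z $ j $ n) x - pd j (\<lambda>z. a z $ n $ h) x) / 2))" for k
    by (simp add: christoffel_def sum_divide_distrib)
  then show ?thesis by (simp only: raise_contract[OF x, of w])
qed

text \<open>
  The covariant derivative of an orthonormal coframe is an infinitesimal rotation: contracting metric compatibility with two coframe vectors shows that the matrix of the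
  covariant derivative is skew, and in two dimensions a skew matrix has a single entry.
\<close>

lemma nabla_coframe:
  assumes x: "x \<in> U"
  shows "cov_deriv a n b h x = n_nabla_b a b nf n x * nf x $ h"
    and "cov_deriv a n nf h x = - n_nabla_b a b nf n x * b x $ h"
proof -
  \<comment> \<open>The Christoffel symbols of the first kind; \<open>compat\<close> below is metric compatibility.\<close>
  define G where "G i j = (pd n (\<lambda>z. a z $ i $ j) x + pd j (\<lambda>z. a z $ i $ n) x - pd i (\<lambda>z. a z $ n $ j) x) / 2"
    for i j
  have cd: "cov_deriv a n w h x = pd n (\<lambda>z. w z $ h) x - (\<Sum>j\<in>UNIV. raise a w x $ j * G j h)" for w h
    unfolding cov_deriv_def G_def christoffel_contract[OF x, symmetric] by (simp add: mult.commute)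
  have symm: "pd n (\<lambda>z. a z $ i $ j) x = pd n (\<lambda>z. a z $ j $ i) x" for n i j
    using pd_metric[OF x, of n i j] pd_metric[OF x, of n j i] by simp
  have compat: "G i j + G j i = pd n (\<lambda>z. b z $ i) x * b x $ j + b x $ i * pd n (\<lambda>z. b z $ j) x +
    (pd n (\<lambda>z. nf z $ i) x * nf x $ j + nf x $ i * pd n (\<lambda>z. nf z $ j) x)" for i j
    unfolding pd_metric[OF x, symmetric] G_def
    by (simp add: symm[of n j i] symm[of i j n] symm[of j n i] field_simps)
  define Z where "Z X Y = (\<Sum>i\<in>UNIV. \<Sum>j\<in>UNIV. X $ i * Y $ j * G i j)" for X Y :: "real^2"
  define d where "d w X = (\<Sum>h\<in>UNIV. X $ h * pd n (\<lambda>z. w z $ h) x)" for w :: covec and X :: "real^2"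
  have Zsum: "Z X Y + Z Y X = d b X * (b x \<bullet> Y) + (b x \<bullet> X) * d b Y + (d nf X * (nf x \<bullet> Y) + (nf x \<bullet> X) * d nf Y)" for X Y
  proof -
    have "Z X Y + Z Y X = (\<Sum>i\<in>UNIV. \<Sum>j\<in>UNIV. X $ i * Y $ j * (G i j + G j i))"
      by (simp add: Z_def sum_2 algebra_simps)
    then show ?thesis
      by (simp add: compat d_def inner_vec_def sum_2 algebra_simps)
  qed
  have Zcd: "(\<Sum>h\<in>UNIV. X $ h * cov_deriv a n w h x) = d w X - Z (raise a w x) X" for w X
    by (simp add: cd Z_def d_def sum_2 algebra_simps)
  note dual = raise_pairing[OF x]
  \<comment> \<open>The three independent entries of the skew-symmetry.\<close>
  have bb: "d b (bvec x) = Z (bvec x) (bvec x)" and nn: "d nf (nvec x) = Z (nvec x) (nvec x)"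
    and bn: "d nf (bvec x) - Z (nvec x) (bvec x) = - (d b (nvec x) - Z (bvec x) (nvec x))"
    using Zsum[of "bvec x" "bvec x"] Zsum[of "nvec x" "nvec x"] Zsum[of "bvec x" "nvec x"] by (simp_all add: dual)
  have om: "n_nabla_b a b nf n x = d b (nvec x) - Z (bvec x) (nvec x)"
    by (simp only: n_nabla_b_def Zcd)
  have c: "(\<Sum>h\<in>UNIV. X $ h * (r * w x $ h)) = r * (w x \<bullet> X)" for X r and w :: covec
    by (simp add: inner_vec_def sum_2 algebra_simps)
  have swap: "bvec x \<bullet> b x = 1" "nvec x \<bullet> b x = 0" "bvec x \<bullet> nf x = 0" "nvec x \<bullet> nf x = 1"
    using dual by (simp_all add: inner_commute)
  show "cov_deriv a n b h x = n_nabla_b a b nf n x * nf x $ h"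
    by (rule eq_from_dual_pairings[OF swap]) (simp_all only: Zcd c dual om bb mult_1_right mult_zero_right diff_self)
  show "cov_deriv a n nf h x = - n_nabla_b a b nf n x * b x $ h"
    by (rule eq_from_dual_pairings[OF swap]) (simp_all only: Zcd c dual om nn bn mult_1_right mult_zero_right diff_self)
qed

section \<open>The structure equations\<close>


text \<open>
  By definition of the covariant derivative, contracting the Christoffel symbols with a covector field gives its partial derivative
  minus its covariant derivative.  By \<open>nabla_coframe\<close> the latter cancels against the \<open>n\<^sup>h \<nabla>\<^sub>n b\<^sub>h\<close> part of \<open>T\<close>, so
  that only \<open>k\<close> and partial derivatives remain.
\<close>

lemma structure_equations:
  assumes x: "x \<in> U"
  shows "(\<Sum>k\<in>UNIV. b x $ k * Lbar a b nf kf k n h x) = pd n (\<lambda>z. b z $ h) x + kf x $ n * nf x $ h"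
    and "(\<Sum>k\<in>UNIV. nf x $ k * Lbar a b nf kf k n h x) = pd n (\<lambda>z. nf z $ h) x - kf x $ n * b x $ h"
proof -
  have "(\<Sum>k\<in>UNIV. w x $ k * Lbar a b nf kf k n h x) =
    (\<Sum>k\<in>UNIV. w x $ k * (\<Sum>j\<in>UNIV. ainv a x k j * eps a x j h)) * T a b nf kf n x
    + (pd n (\<lambda>z. w z $ h) x - cov_deriv a n w h x)" for w :: covec
    unfolding Lbar_def Lcoef_def cov_deriv_def
    by (simp add: sum_2 algebra_simps)
  then show "(\<Sum>k\<in>UNIV. b x $ k * Lbar a b nf kf k n h x) = pd n (\<lambda>z. b z $ h) x + kf x $ n * nf x $ h"
    "(\<Sum>k\<in>UNIV. nf x $ k * Lbar a b nf kf k n h x) = pd n (\<lambda>z. nf z $ h) x - kf x $ n * b x $ h"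
    by (simp_all only: eps_contract[OF x] nabla_coframe[OF x] T_def) (simp_all add: algebra_simps)
qed

text \<open>
  Solving the structure equations for \<open>Lbar\<close> by Cramer's rule displays it as a rational expression in the coframe, its
  first derivatives and \<open>k\<close>.
\<close>

lemma Lbar_differentiable:
  assumes x: "x \<in> U" and kf: "smooth_covector_field_on U kf"
  shows "Lbar a b nf kf k n h differentiable (at x)"
proof -
  define D where "D z = b z $ 1 * nf z $ 2 - b z $ 2 * nf z $ 1" for z
  define \<beta> where "\<beta> z = pd n (\<lambda>z. b z $ h) z + kf z $ n * nf z $ h" for z
  define \<nu> where "\<nu> z = pd n (\<lambda>z. nf z $ h) z - kf z $ n * b z $ h" for z
  define g where "g z = (if k = 1 then nf z $ 2 * \<beta> z - b z $ 2 * \<nu> z else b z $ 1 * \<nu> z - nf z $ 1 * \<beta> z) / D z" for z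
  have D: "D z \<noteq> 0" if "z \<in> U" for z
  proof
    assume "D z = 0"
    moreover have "D z * (bvec z $ 1 * nvec z $ 2 - bvec z $ 2 * nvec z $ 1) =
      (b z \<bullet> bvec z) * (nf z \<bullet> nvec z) - (nf z \<bullet> bvec z) * (b z \<bullet> nvec z)"
      by (simp add: D_def inner_vec_def sum_2 algebra_simps)
    ultimately show False using raise_pairing[OF that] by simp
  qed
  have "g z = Lbar a b nf kf k n h z" if "z \<in> U" for z
  proof -
    have "D z * Lbar a b nf kf 1 n h z = nf z $ 2 * \<beta> z - b z $ 2 * \<nu> z"
      "D z * Lbar a b nf kf 2 n h z = b z $ 1 * \<nu> z - nf z $ 1 * \<beta> z"
      unfolding \<beta>_def \<nu>_def structure_equations[OF that, symmetric]
      by (simp_all add: D_def sum_2 algebra_simps)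
    then show ?thesis
      using exhaust_2[of k] D[OF that] by (auto simp: g_def field_simps)
  qed
  moreover have "g differentiable (at x)"
  proof -
    have kd: "(\<lambda>z. kf z $ i) differentiable (at x)" for i
      using kf x smooth_on_differentiable unfolding smooth_covector_field_on_def by blast
    have pdd: "(\<lambda>z. pd n (\<lambda>z. b z $ h) z) differentiable (at x)" "(\<lambda>z. pd n (\<lambda>z. nf z $ h) z) differentiable (at x)"
      using smooth_on_pd_differentiable[OF _ x] smooth by auto
    note d = differentiable_coframe[OF x] kd pdd
    have \<beta>: "\<beta> differentiable (at x)" and \<nu>: "\<nu> differentiable (at x)" and Dd: "D differentiable (at x)"
      unfolding \<beta>_def[abs_def] \<nu>_def[abs_def] D_def[abs_def]
      by (intro differentiable_add differentiable_diff differentiable_mult d)+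
    show ?thesis
      unfolding g_def[abs_def]
      by (cases "k = 1") (simp_all add: D[OF x] d \<beta> \<nu> Dd)
  qed
  ultimately show ?thesis
    unfolding differentiable_def
    using has_derivative_transform_within_open[of g _ x UNIV U "Lbar a b nf kf k n h"] open_U x by blast
qed

text \<open>
  The structure equations for \<open>b\<close> and \<open>n\<close> differ only by the exchange of the two covectors and by a sign.  The fact \<open>contract\<close>
  treats both at once: \<open>w\<close> is the covector to contract with, \<open>v\<close> the other one and \<open>s\<close> the sign.
\<close>

lemma curvature_Lbar:
  assumes x: "x \<in> U" and kf: "smooth_covector_field_on U kf"
  shows "curvature (Lbar a b nf kf) k n i j x =
    (\<Sum>t\<in>UNIV. ainv a x n t * eps a x t k) * (pd i (\<lambda>z. kf z $ j) x - pd j (\<lambda>z. kf z $ i) x)"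
proof -
  define G where "G = Lbar a b nf kf"
  have kd: "(\<lambda>z. kf z $ i) differentiable (at x)" for i
    using kf x smooth_on_differentiable unfolding smooth_covector_field_on_def by blast
  have Gd: "G k n h differentiable (at x)" for k n h
    unfolding G_def by (rule Lbar_differentiable[OF x kf])
  have contract: "(\<Sum>n\<in>UNIV. w x $ n * curvature G k n i j x) =
      s * v x $ k * (pd i (\<lambda>z. kf z $ j) x - pd j (\<lambda>z. kf z $ i) x)"
    if w: "\<And>h. smooth_on U (\<lambda>z. w z $ h)" and v: "\<And>h. smooth_on U (\<lambda>z. v z $ h)"
      and Gw: "\<And>z n h. z \<in> U \<Longrightarrow> (\<Sum>k\<in>UNIV. w z $ k * G k n h z) = pd n (\<lambda>z. w z $ h) z + s * (kf z $ n * v z $ h)"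
      and Gv: "\<And>z n h. z \<in> U \<Longrightarrow> (\<Sum>k\<in>UNIV. v z $ k * G k n h z) = pd n (\<lambda>z. v z $ h) z - s * (kf z $ n * w z $ h)"
    for w v :: covec and s :: real
  proof -
    note wd = smooth_on_differentiable[OF w x] and vd = smooth_on_differentiable[OF v x]
    define K where "K i = kf x $ i" for i
    define dK where "dK i j = pd i (\<lambda>z. kf z $ j) x" for i j
    define dw where "dw i h = pd i (\<lambda>z. w z $ h) x" for i h
    define dv where "dv i h = pd i (\<lambda>z. v z $ h) x" for i h
    define ddw where "ddw i j = pd i (pd j (\<lambda>z. w z $ k)) x" for i j
    define dG where "dG i m j = pd i (G m j k) x" for i m j
    \<comment> \<open>The derivative of the structure equation for \<open>w\<close>.\<close>
    have d: "(\<Sum>m\<in>UNIV. dw i m * G m j k x + w x $ m * dG i m j) =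
        ddw i j + s * (dK i j * v x $ k + K j * dv i k)" for i j
    proof -
      have "pd i (\<lambda>z. w z $ 1 * G 1 j k z + w z $ 2 * G 2 j k z) x
        = pd i (\<lambda>z. pd j (\<lambda>z. w z $ k) z + s * (kf z $ j * v z $ k)) x"
        by (rule pd_cong_open[OF open_U x]) (use Gw in \<open>simp add: sum_2\<close>)
      then show ?thesis
        using wd vd kd Gd smooth_on_pd_differentiable[OF w x, of j k]
        by (simp add: pd_add pd_mult pd_const sum_2 dw_def dG_def ddw_def dK_def K_def dv_def add_ac)
    qed
    have sym: "ddw i j = ddw j i"
      unfolding ddw_def using smooth_on_pd_commute[OF w open_U x] .
    \<comment> \<open>In a quadratic term of the curvature the structure equation for \<open>w\<close> applies first, then the one for \<open>v\<close>.\<close>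
    have GG: "(\<Sum>m\<in>UNIV. G m j k x * (\<Sum>n\<in>UNIV. w x $ n * G n i m x)) =
        (\<Sum>m\<in>UNIV. dw i m * G m j k x) + s * K i * (dv j k - s * (K j * w x $ k))" for i j
    proof -
      have "(\<Sum>m\<in>UNIV. G m j k x * (\<Sum>n\<in>UNIV. w x $ n * G n i m x)) =
          (\<Sum>m\<in>UNIV. dw i m * G m j k x) + s * K i * (\<Sum>m\<in>UNIV. v x $ m * G m j k x)"
        unfolding Gw[OF x] dw_def K_def by (simp add: sum_2 algebra_simps)
      then show ?thesis unfolding Gv[OF x] dv_def K_def .
    qed
    have "(\<Sum>n\<in>UNIV. w x $ n * curvature G k n i j x) =
        (\<Sum>m\<in>UNIV. w x $ m * dG i m j) - (\<Sum>m\<in>UNIV. w x $ m * dG j m i)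
        + (\<Sum>m\<in>UNIV. G m j k x * (\<Sum>n\<in>UNIV. w x $ n * G n i m x))
        - (\<Sum>m\<in>UNIV. G m i k x * (\<Sum>n\<in>UNIV. w x $ n * G n j m x))"
      by (simp add: curvature_def dG_def sum_2 algebra_simps)
    also have "\<dots> = s * v x $ k * (dK i j - dK j i)"
      using d[of i j] d[of j i] sym unfolding GG sum.distrib by (simp add: algebra_simps)
    finally show ?thesis by (simp add: dK_def)
  qed
  have b: "(\<Sum>n\<in>UNIV. b x $ n * curvature G k n i j x) =
      nf x $ k * (pd i (\<lambda>z. kf z $ j) x - pd j (\<lambda>z. kf z $ i) x)"
    using contract[of b nf 1] smooth structure_equations by (simp add: G_def)
  have nf: "(\<Sum>n\<in>UNIV. nf x $ n * curvature G k n i j x) =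
      - b x $ k * (pd i (\<lambda>z. kf z $ j) x - pd j (\<lambda>z. kf z $ i) x)"
    using contract[of nf b "-1"] smooth structure_equations by (simp add: G_def)
  show ?thesis
    unfolding G_def[symmetric]
  proof (rule eq_from_dual_pairings[OF raise_pairing[OF x], where X = "\<lambda>m. curvature G k m i j x"
      and Y = "\<lambda>m. (\<Sum>t\<in>UNIV. ainv a x m t * eps a x t k) * (pd i (\<lambda>z. kf z $ j) x - pd j (\<lambda>z. kf z $ i) x)"])
    have c: "(\<Sum>m\<in>UNIV. w $ m * (Y m * r)) = (\<Sum>m\<in>UNIV. w $ m * Y m) * r" for w :: "real^2" and Y and r :: real
      by (simp add: sum_distrib_right mult.assoc)
    show "(\<Sum>m\<in>UNIV. b x $ m * curvature G k m i j x) = (\<Sum>m\<in>UNIV. b x $ m *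
        ((\<Sum>t\<in>UNIV. ainv a x m t * eps a x t k) * (pd i (\<lambda>z. kf z $ j) x - pd j (\<lambda>z. kf z $ i) x)))"
      by (simp only: b c eps_contract[OF x])
    show "(\<Sum>m\<in>UNIV. nf x $ m * curvature G k m i j x) = (\<Sum>m\<in>UNIV. nf x $ m *
        ((\<Sum>t\<in>UNIV. ainv a x m t * eps a x t k) * (pd i (\<lambda>z. kf z $ j) x - pd j (\<lambda>z. kf z $ i) x)))"
      by (simp only: nf c eps_contract[OF x])
  qed
qed

text \<open>
  The difference of the two connections is the quarter turn times \<open>T\<^sub>n\<close>; contraction with \<open>b\<close> gives \<open>T\<^sub>n\<close> times the
  nonzero covector \<open>n\<close>.
\<close>

lemma Lbar_eq_christoffel_iff:
  assumes x: "x \<in> U"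
  shows "(\<forall>k h. Lbar a b nf kf k n h x = christoffel a k n h x) \<longleftrightarrow> kf x $ n = - n_nabla_b a b nf n x"
proof
  assume *: "\<forall>k h. Lbar a b nf kf k n h x = christoffel a k n h x"
  have "(\<Sum>j\<in>UNIV. ainv a x k j * eps a x j h) * T a b nf kf n x = 0" for k h
    using *[rule_format, of k h] by (simp add: Lbar_def Lcoef_def)
  then have "(\<Sum>k\<in>UNIV. b x $ k * ((\<Sum>j\<in>UNIV. ainv a x k j * eps a x j h) * T a b nf kf n x)) = 0" for h
    by (simp only: mult_zero_right sum.neutral_const)
  then have "(\<Sum>k\<in>UNIV. b x $ k * (\<Sum>j\<in>UNIV. ainv a x k j * eps a x j h)) * T a b nf kf n x = 0" for h
    by (simp only: sum_distrib_right mult.assoc)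
  then have "nf x $ h * T a b nf kf n x = 0" for h
    by (simp only: eps_contract[OF x])
  moreover have "nf x \<noteq> 0"
    using raise_pairing(4)[OF x] by auto
  ultimately have "T a b nf kf n x = 0"
    by (metis mult_eq_0_iff vec_eq_iff zero_index)
  then show "kf x $ n = - n_nabla_b a b nf n x" by (simp add: T_def)
qed (simp add: Lbar_def Lcoef_def T_def)

section \<open>The angle function\<close>

lemma S_coframe:
  assumes x: "x \<in> U"
  shows "S a x y = sqrt ((b x \<bullet> y)\<^sup>2 + (nf x \<bullet> y)\<^sup>2)"
  by (simp add: S_def metric_coframe[OF x] inner_vec_def sum_2 power2_eq_square algebra_simps)

lemma coframe_square_pos:
  assumes x: "x \<in> U" and "y \<noteq> 0"
  shows "(b x \<bullet> y)\<^sup>2 + (nf x \<bullet> y)\<^sup>2 > 0"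
proof (rule ccontr)
  assume "\<not> ?thesis"
  then have "b x \<bullet> y = 0" "nf x \<bullet> y = 0"
    by (simp_all add: sum_power2_gt_zero_iff)
  then have "y $ k = 0" for k
    using eq_from_dual_pairings[OF raise_pairing[OF x], of "\<lambda>k. y $ k" "\<lambda>k. 0" k]
    by (simp add: inner_vec_def)
  with \<open>y \<noteq> 0\<close> show False by (simp add: vec_eq_iff)
qed

text \<open>
  The conditions on the vertical derivatives of \<open>\<theta>\<close> say that on each fibre its differential is the pullback of the winding form under
  \<open>(b(y), n(y))\<close>.  The initial condition is at \<open>y = b\<close>, where this pair is \<open>(1, 0)\<close>.
\<close>

lemma angle_polar:
  assumes \<theta>: "angle_function U W a b \<theta>" and xy: "(x, y) \<in> W"
  shows "b x \<bullet> y = S a x y * cos (\<theta> x y)" and "nf x \<bullet> y = S a x y * sin (\<theta> x y)"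
proof -
  note ang = \<theta>[unfolded angle_function_def conic_region_over_def]
  have x: "x \<in> U" using ang xy by auto
  define X where "X = {y. (x, y) \<in> W}"
  have "open X"
  proof -
    have "X = (\<lambda>y. (x, y)) -` W" by (auto simp: X_def)
    then show ?thesis
      using ang open_vimage[of W "\<lambda>y. (x, y)"] by (auto intro!: continuous_intros)
  qed
  have "connected X" using ang x by (auto simp: X_def)
  have pos: "(b x \<bullet> y)\<^sup>2 + (nf x \<bullet> y)\<^sup>2 > 0" if "y \<in> X" for y
    using coframe_square_pos[OF x] ang that by (auto simp: X_def)
  have d: "(\<theta> x has_derivative (\<lambda>v. ((b x \<bullet> y) * (nf x \<bullet> v) - (nf x \<bullet> y) * (b x \<bullet> v)) /
      ((b x \<bullet> y)\<^sup>2 + (nf x \<bullet> y)\<^sup>2))) (at y)" if y: "y \<in> X" for y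
  proof -
    have W: "(x, y) \<in> W" using y by (simp add: X_def)
    have "(\<lambda>(x, y). \<theta> x y) differentiable (at (x, y))"
      using smooth_on_differentiable[of W] ang W by blast
    then have "((\<lambda>(x, y). \<theta> x y) \<circ> Pair x) differentiable (at y)"
      by (intro differentiable_chain_at) (auto intro!: derivative_intros simp: differentiable_def)
    then have dx: "\<theta> x differentiable (at y)" by (simp add: comp_def)
    define R where "R = (b x \<bullet> y)\<^sup>2 + (nf x \<bullet> y)\<^sup>2"
    have R: "R > 0" using pos[OF y] by (simp add: R_def)
    have S: "S a x y = sqrt R" by (simp add: S_coframe[OF x] R_def)
    have pd: "pd i (\<theta> x) y = ((b x \<bullet> y) * nf x $ i - (nf x \<bullet> y) * b x $ i) / R" for i
    proof -
      have "sqrt R * pd i (\<theta> x) y = m_low a x y i" using ang W S by auto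
      also have "\<dots> = ((b x \<bullet> y) * nf x $ i - (nf x \<bullet> y) * b x $ i) / sqrt R"
        by (simp add: m_low_def S eps_coframe[OF x] inner_vec_def sum_2 diff_divide_distrib add_divide_distrib algebra_simps)
      finally have e: "sqrt R * pd i (\<theta> x) y = ((b x \<bullet> y) * nf x $ i - (nf x \<bullet> y) * b x $ i) / sqrt R" .
      have "R * pd i (\<theta> x) y = sqrt R * (sqrt R * pd i (\<theta> x) y)"
        using R by (simp flip: mult.assoc)
      also have "\<dots> = (b x \<bullet> y) * nf x $ i - (nf x \<bullet> y) * b x $ i"
        unfolding e using R by simp
      finally have "R * pd i (\<theta> x) y = (b x \<bullet> y) * nf x $ i - (nf x \<bullet> y) * b x $ i" .
      then show ?thesis using R by (simp add: field_simps)
    qed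
    have "frechet_derivative (\<theta> x) (at y) v = ((b x \<bullet> y) * (nf x \<bullet> v) - (nf x \<bullet> y) * (b x \<bullet> v)) / R" for v
      unfolding frechet_derivative_eq_pd[OF dx] pd
      by (simp add: inner_vec_def sum_2 diff_divide_distrib add_divide_distrib algebra_simps)
    then show ?thesis
      using dx[unfolded frechet_derivative_works] unfolding R_def by (metis (no_types, lifting) ext)
  qed
  have "bvec x \<in> X" "\<theta> x (bvec x) = 0" "y \<in> X"
    using ang x xy by (auto simp: X_def)
  have di: "((\<bullet>) w has_derivative (\<bullet>) w) (at v)" for w v :: "real^2"
    by (rule bounded_linear_imp_has_derivative[OF bounded_linear_inner_right])
  have b0: "b x \<bullet> bvec x > 0" "nf x \<bullet> bvec x = 0"
    by (simp_all add: raise_pairing[OF x])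
  note p = polar_angle_unique[OF \<open>open X\<close> \<open>connected X\<close> di di pos d
      \<open>bvec x \<in> X\<close> b0 \<open>\<theta> x (bvec x) = 0\<close> \<open>y \<in> X\<close>]
  show "b x \<bullet> y = S a x y * cos (\<theta> x y)"
    unfolding S_coframe[OF x] by (rule p(1))
  show "nf x \<bullet> y = S a x y * sin (\<theta> x y)"
    unfolding S_coframe[OF x] by (rule p(2))
qed

text \<open>
  The vector \<open>m\<close> is the unit vector of \<open>y\<close> turned by a right angle, with components \<open>(- sin \<theta>, cos \<theta>)\<close> in the coframe.
\<close>

lemma m_up_contract:
  assumes x: "x \<in> U"
  shows "(\<Sum>k\<in>UNIV. b x $ k * m_up a x y k) = - (nf x \<bullet> y) / S a x y"
    and "(\<Sum>k\<in>UNIV. nf x $ k * m_up a x y k) = (b x \<bullet> y) / S a x y"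
proof -
  have "(\<Sum>k\<in>UNIV. w x $ k * m_up a x y k) =
    ((nf x \<bullet> raise a w x) * (b x \<bullet> y) - (b x \<bullet> raise a w x) * (nf x \<bullet> y)) / S a x y" for w
    unfolding m_up_def raise_contract[OF x, of w]
    by (simp add: m_low_def eps_coframe[OF x] inner_vec_def sum_2 diff_divide_distrib add_divide_distrib algebra_simps)
  then show "(\<Sum>k\<in>UNIV. b x $ k * m_up a x y k) = - (nf x \<bullet> y) / S a x y"
    "(\<Sum>k\<in>UNIV. nf x $ k * m_up a x y k) = (b x \<bullet> y) / S a x y"
    by (simp_all add: raise_pairing[OF x])
qed

text \<open>
  In coframe components the definition of \<open>L\<close> becomes, up to sign and apart from \<open>k\<close>, the product rule for the derivative in \<open>x\<close> of
  \<open>S cos \<theta>\<close> and \<open>S sin \<theta>\<close>.  By \<open>angle_polar\<close> these are \<open>b(y)\<close> and \<open>n(y)\<close>, whose derivatives appear in the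
  structure equations.
\<close>

lemma L_eq_Lcoef:
  assumes \<theta>: "angle_function U W a b \<theta>" and xy: "(x, y) \<in> W"
  shows "L a \<theta> kf k n x y = (\<Sum>h\<in>UNIV. Lcoef a b nf kf k n h x * y $ h)"
proof -
  note ang = \<theta>[unfolded angle_function_def conic_region_over_def]
  have x: "x \<in> U" and y: "y \<noteq> 0" using ang xy by auto
  \<comment> \<open>The polar identities hold near \<open>x\<close> with \<open>y\<close> fixed because the conic region is open.\<close>
  define N where "N = {z. (z, y) \<in> W}"
  have "open N"
  proof -
    have "N = (\<lambda>z. (z, y)) -` W" by (auto simp: N_def)
    then show ?thesis
      using ang open_vimage[of W "\<lambda>z. (z, y)"] by (auto intro!: continuous_intros)
  qed
  have "x \<in> N" using xy by (simp add: N_def)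
  define s where "s z = S a z y" for z
  define t where "t z = \<theta> z y" for z
  have spos: "s x > 0"
    using coframe_square_pos[OF x y] by (simp add: s_def S_coframe[OF x])
  have sd: "s differentiable (at x)"
  proof -
    define q where "q z = (\<Sum>i\<in>UNIV. \<Sum>j\<in>UNIV. a z $ i $ j * y $ i * y $ j)" for z
    have "q differentiable (at x)"
      unfolding q_def[abs_def] by (auto simp: differentiable_coframe[OF x])
    moreover have "q x > 0" using spos by (simp add: s_def S_def q_def)
    ultimately show ?thesis
      unfolding s_def[abs_def] S_def q_def[symmetric]
      using has_derivative_compose[OF _ DERIV_real_sqrt[unfolded has_field_derivative_def], of q _ x UNIV]
      unfolding differentiable_def by blast
  qed
  have td: "t differentiable (at x)"
  proof -
    have "(\<lambda>(x, y). \<theta> x y) differentiable (at (x, y))"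
      using smooth_on_differentiable[of W] ang xy by blast
    then have "((\<lambda>(x, y). \<theta> x y) \<circ> (\<lambda>z. (z, y))) differentiable (at x)"
      by (intro differentiable_chain_at) (auto intro!: derivative_intros simp: differentiable_def)
    then show ?thesis by (simp add: comp_def t_def[abs_def])
  qed
  have cs: "(\<lambda>z. cos (t z)) differentiable (at x)" "(\<lambda>z. sin (t z)) differentiable (at x)"
    using td has_derivative_cos has_derivative_sin unfolding differentiable_def by blast+
  have pdcs: "pd n (\<lambda>z. cos (t z)) x = - sin (t x) * pd n t x" "pd n (\<lambda>z. sin (t z)) x = cos (t x) * pd n t x"
    by (rule pd_chain[OF td], rule DERIV_cos) (rule pd_chain[OF td], rule DERIV_sin)
  have inner: "pd n (\<lambda>z. w z \<bullet> y) x = (\<Sum>h\<in>UNIV. pd n (\<lambda>z. w z $ h) x * y $ h)"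
    if "\<And>h. (\<lambda>z. w z $ h) differentiable (at x)" for w
    using that by (simp add: inner_vec_def sum_2 pd_add pd_mult pd_const)
  have b: "(\<Sum>h\<in>UNIV. pd n (\<lambda>z. b z $ h) x * y $ h) = pd n s x * cos (t x) - s x * sin (t x) * pd n t x"
  proof -
    have "pd n (\<lambda>z. b z \<bullet> y) x = pd n (\<lambda>z. s z * cos (t z)) x"
      by (rule pd_cong_open[OF \<open>open N\<close> \<open>x \<in> N\<close>]) (simp add: N_def s_def t_def angle_polar[OF \<theta>])
    then show ?thesis
      by (simp add: inner differentiable_coframe[OF x] pd_mult sd cs pdcs)
  qed
  have nf: "(\<Sum>h\<in>UNIV. pd n (\<lambda>z. nf z $ h) x * y $ h) = pd n s x * sin (t x) + s x * cos (t x) * pd n t x"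
  proof -
    have "pd n (\<lambda>z. nf z \<bullet> y) x = pd n (\<lambda>z. s z * sin (t z)) x"
      by (rule pd_cong_open[OF \<open>open N\<close> \<open>x \<in> N\<close>]) (simp add: N_def s_def t_def angle_polar[OF \<theta>])
    then show ?thesis
      by (simp add: inner differentiable_coframe[OF x] pd_mult sd cs pdcs)
  qed
  have polar: "b x \<bullet> y = s x * cos (t x)" "nf x \<bullet> y = s x * sin (t x)"
    using angle_polar[OF \<theta> xy] by (simp_all add: s_def t_def)
  have L: "(\<Sum>k\<in>UNIV. w $ k * L a \<theta> kf k n x y) =
    - (w \<bullet> y) / s x * pd n s x - s x * (\<Sum>k\<in>UNIV. w $ k * m_up a x y k) * (pd n t x - kf x $ n)" for w
    by (simp add: L_def s_def[abs_def] t_def[abs_def] inner_vec_def sum_2 diff_divide_distrib add_divide_distrib algebra_simps)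
  have Lc: "(\<Sum>k\<in>UNIV. w $ k * (\<Sum>h\<in>UNIV. Lcoef a b nf kf k n h x * y $ h)) =
    - (\<Sum>h\<in>UNIV. (\<Sum>k\<in>UNIV. w $ k * Lbar a b nf kf k n h x) * y $ h)" for w :: "real^2"
    by (simp add: Lbar_def sum_2 algebra_simps)
  have split: "(\<Sum>h\<in>UNIV. (X h + r * v $ h) * y $ h) = (\<Sum>h\<in>UNIV. X h * y $ h) + r * (v \<bullet> y)"
    "(\<Sum>h\<in>UNIV. (X h - r * v $ h) * y $ h) = (\<Sum>h\<in>UNIV. X h * y $ h) - r * (v \<bullet> y)"
    for X :: "idx \<Rightarrow> real" and r and v :: "real^2"
    by (simp_all add: inner_vec_def sum_2 algebra_simps)
  show ?thesis
  proof (rule eq_from_dual_pairings[OF raise_pairing[OF x], where X = "\<lambda>k. L a \<theta> kf k n x y"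
      and Y = "\<lambda>k. \<Sum>h\<in>UNIV. Lcoef a b nf kf k n h x * y $ h"])
    show "(\<Sum>k\<in>UNIV. b x $ k * L a \<theta> kf k n x y) =
        (\<Sum>k\<in>UNIV. b x $ k * (\<Sum>h\<in>UNIV. Lcoef a b nf kf k n h x * y $ h))"
      unfolding L Lc structure_equations[OF x] split b nf m_up_contract[OF x] polar s_def[symmetric]
      using spos by (simp add: field_simps)
    show "(\<Sum>k\<in>UNIV. nf x $ k * L a \<theta> kf k n x y) =
        (\<Sum>k\<in>UNIV. nf x $ k * (\<Sum>h\<in>UNIV. Lcoef a b nf kf k n h x * y $ h))"
      unfolding L Lc structure_equations[OF x] split b nf m_up_contract[OF x] polar s_def[symmetric]
      using spos by (simp add: field_simps)
  qed
qed

end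

theorem mainTheorem7:
  fixes U :: "(real^2) set"
    and a :: "real^2 \<Rightarrow> real^2^2"
    and b nf kf :: "real^2 \<Rightarrow> real^2"
    and W :: "((real^2) \<times> (real^2)) set"
    and \<theta> :: "real^2 \<Rightarrow> real^2 \<Rightarrow> real"
  assumes "open U"
    and "riemannian_metric_on U a"
    and "oriented_orthonormal_on U a b nf"
    and "angle_function U W a b \<theta>"
    and "smooth_covector_field_on U kf"
  shows "(\<forall>(x, y)\<in>W. \<forall>k n. L a \<theta> kf k n x y = (\<Sum>h\<in>UNIV. Lcoef a b nf kf k n h x * y $ h)) \<and>
    (\<forall>x\<in>U. \<forall>k n i j. curvature (Lbar a b nf kf) k n i j x =
       (\<Sum>t\<in>UNIV. ainv a x n t * eps a x t k) *
         (pd i (\<lambda>z. kf z $ j) x - pd j (\<lambda>z. kf z $ i) x)) \<and>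
    ((\<forall>x\<in>U. \<forall>k n h. Lbar a b nf kf k n h x = christoffel a k n h x) \<longleftrightarrow>
       (\<forall>x\<in>U. \<forall>n. kf x $ n = - n_nabla_b a b nf n x)) \<and>
    ((\<forall>x\<in>U. \<forall>n. kf x $ n = - n_nabla_b a b nf n x) \<longrightarrow>
       (\<forall>x\<in>U. \<forall>k n i j. curvature (Lbar a b nf kf) k n i j x = riemann_curvature a k n i j x))"
proof -
  interpret oriented_coframe U a b nf
    using assms by unfold_locales
  have iff: "(\<forall>x\<in>U. \<forall>k n h. Lbar a b nf kf k n h x = christoffel a k n h x) \<longleftrightarrow>
      (\<forall>x\<in>U. \<forall>n. kf x $ n = - n_nabla_b a b nf n x)"
    using Lbar_eq_christoffel_iff[of _ kf] by blast
  have "curvature (Lbar a b nf kf) k n i j x = riemann_curvature a k n i j x"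
    if "\<forall>x\<in>U. \<forall>n. kf x $ n = - n_nabla_b a b nf n x" and x: "x \<in> U" for k n i j x
  proof -
    have eq: "Lbar a b nf kf k n h z = christoffel a k n h z" if "z \<in> U" for k n h z
      using iff \<open>\<forall>x\<in>U. \<forall>n. kf x $ n = - n_nabla_b a b nf n x\<close> that by blast
    have "pd i (Lbar a b nf kf n j k) x = pd i (christoffel a n j k) x" for i n j k
      by (rule pd_cong_open[OF open_U x]) (rule eq)
    then show ?thesis
      by (simp add: riemann_curvature_def curvature_def eq[OF x])
  qed
  then show ?thesis
    using iff L_eq_Lcoef[OF assms(4), of _ _ kf] curvature_Lbar[OF _ assms(5)] by (intro conjI) blast+
qed

end
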